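(* Let $\Gamma\cup\{A\}$ be a set of ordinary formulas. Then: $\Gamma\vdash_m A$ if and only if $l_m(\Gamma)\vdash_{(m)}l_m(A)$; $\Gamma\vdash_i A$ if and only if $l_i(\Gamma)\vdash_{(i)}l_i(A)$; $\Gamma\vdash_c A$ if and only if $l_c(\Gamma)\vdash_{pml}l_c(A)$.
   Context: Ordinary formulas. Let $\mathcal V=\{X,Y,Z,\dots\}$ be a countable set of propositional variables and $\perp$ a constant. Ordinary formulas are built from $\mathcal V\cup\{\perp\}$ using $\wedge,\vee,\to$; $\neg A$ abbreviates $A\to\perp$. Mixed formulas. Let $\mathcal V_m=\{X_m:X\in\mathcal V\}$ (minimal variables), $\mathcal V_i=\{X_i:X\in\mathcal V\}$ (intuitionistic variables), $\mathcal V_c=\{X_c:X\in\mathcal V\}$ (classical variables) be three disjoint indexed copies of $\mathcal V$. Mixed formulas are built from $\mathcal V_m\cup\mathcal V_i\cup\mathcal V_c\cup\{\perp\}$ using $\wedge,\vee,\to$, with $\neg A=A\to\perp$. A mixed formula is classical if all its variables are in $\mathcal V_c$, and intuitionistic if all its variables are in $\mathcal V_i\cup\mathcal V_c$. Rules. Sequents are $\Gamma\vdash A$ with $\Gamma\cup\{A\}$ a finite set of formulas; commas denote union. Basic rules ($j\in\{1,2\}$): (Ax) $A\vdash A$; (W) from $\Gamma\vdash A$ infer $\Gamma,B\vdash A$; ($\wedge_I$) from $\Gamma_1\vdash A_1$ and $\Gamma_2\vdash A_2$ infer $\Gamma_1,\Gamma_2\vdash A_1\wedge A_2$; ($\wedge_E$)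 from $\Gamma\vdash A_1\wedge A_2$ infer $\Gamma\vdash A_j$; ($\vee_I$) from $\Gamma\vdash A_j$ infer $\Gamma\vdash A_1\vee A_2$; ($\vee_E$) from $\Gamma_1\vdash A_1\vee A_2$, $\Gamma_2,A_1\vdash B$ and $\Gamma_3,A_2\vdash B$ infer $\Gamma_1,\Gamma_2,\Gamma_3\vdash B$; ($\to_I$) from $\Gamma,A_1\vdash A_2$ infer $\Gamma\vdash A_1\to A_2$; ($\to_E$) from $\Gamma_1\vdash A_1\to A_2$ and $\Gamma_2\vdash A_1$ infer $\Gamma_1,\Gamma_2\vdash A_2$. Absurdity rules: ($\perp_i$) from $\Gamma\vdash\perp$ infer $\Gamma\vdash A$; ($\perp_c$) from $\Gamma\vdash\neg\neg A$ infer $\Gamma\vdash A$. Ordinary systems (on ordinary formulas): minimal logic PLM (derivability $\vdash_m$) has the basic rules; intuitionistic logic PLI ($\vdash_i$) adds $(\perp_i)$ for all formulas $A$; classical logic PLC ($\vdash_c$) adds moreover $(\perp_c)$ for all formulas $A$. Mixed system PML (on mixed formulas): the basic rules, $(\perp_i)$ restricted to intuitionistic mixed formulas $A$, and $(\perp_c)$ restricted to classical mixed formulas $A$; derivability is $\vdash_{pml}$. $\vdash_{(i)}$ denotes derivability in PML without the rule $(\perp_c)$, and $\vdash_{(m)}$ derivability in PML without the rules $(\perp_i)$ and $(\perp_c)$. In all systems, derivability from an infinite $\Gamma$ means derivability from some finite subset. Labels. $l_m,l_i,l_c$ are the maps from ordinary to mixed formulas that replace every variable $X\in\mathcal V$ by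 $X_m$, $X_i$, $X_c$ respectively, and commute with $\perp,\wedge,\vee,\to$. For a set $\Gamma$, $l(\Gamma)=\{l(B):B\in\Gamma\}$. *)

theory Defs
  imports Main "HOL-Library.Countable"
begin

datatype (atoms: 'v) fm =
    Var 'v
  | Bot (\<open>\<^bold>\<bottom>\<close>)
  | And "'v fm" "'v fm" (infixr \<open>\<^bold>\<and>\<close> 70)
  | Or "'v fm" "'v fm" (infixr \<open>\<^bold>\<or>\<close> 65)
  | Imp "'v fm" "'v fm" (infixr \<open>\<^bold>\<longrightarrow>\<close> 60)
  for map: map_fm

abbreviation Neg :: "'v fm \<Rightarrow> 'v fm" (\<open>\<^bold>\<not> _\<close> [75] 75) where
  "\<^bold>\<not> A \<equiv> A \<^bold>\<longrightarrow> \<^bold>\<bottom>"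


text \<open>
  All systems share the basic rules and differ only in the formulas to which the two absurdity
  rules apply: \<open>I\<close> is the set of admissible conclusions of \<open>absurd_i\<close>, and \<open>C\<close> that of
  \<open>absurd_c\<close>.  Antecedents of derivable sequents are finite (lemma \<open>sequent_finite\<close> below).
\<close>

inductive sequent :: "'a fm set \<Rightarrow> 'a fm set \<Rightarrow> 'a fm set \<Rightarrow> 'a fm \<Rightarrow> bool"
  for I C :: "'a fm set"
where
  ax: "sequent I C {A} A"
| weaken: "sequent I C \<Gamma> A \<Longrightarrow> sequent I C (insert B \<Gamma>) A"
| andI: "sequent I C \<Gamma>1 A1 \<Longrightarrow> sequent I C \<Gamma>2 A2 \<Longrightarrow> sequent I C (\<Gamma>1 \<union> \<Gamma>2) (A1 \<^bold>\<and> A2)"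
| andE1: "sequent I C \<Gamma> (A1 \<^bold>\<and> A2) \<Longrightarrow> sequent I C \<Gamma> A1"
| andE2: "sequent I C \<Gamma> (A1 \<^bold>\<and> A2) \<Longrightarrow> sequent I C \<Gamma> A2"
| orI1: "sequent I C \<Gamma> A1 \<Longrightarrow> sequent I C \<Gamma> (A1 \<^bold>\<or> A2)"
| orI2: "sequent I C \<Gamma> A2 \<Longrightarrow> sequent I C \<Gamma> (A1 \<^bold>\<or> A2)"
| orE: "sequent I C \<Gamma>1 (A1 \<^bold>\<or> A2) \<Longrightarrow> sequent I C (insert A1 \<Gamma>2) B \<Longrightarrow>
        sequent I C (insert A2 \<Gamma>3) B \<Longrightarrow> sequent I C (\<Gamma>1 \<union> \<Gamma>2 \<union> \<Gamma>3) B"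
| impI: "sequent I C (insert A1 \<Gamma>) A2 \<Longrightarrow> sequent I C \<Gamma> (A1 \<^bold>\<longrightarrow> A2)"
| impE: "sequent I C \<Gamma>1 (A1 \<^bold>\<longrightarrow> A2) \<Longrightarrow> sequent I C \<Gamma>2 A1 \<Longrightarrow> sequent I C (\<Gamma>1 \<union> \<Gamma>2) A2"
| absurd_i: "sequent I C \<Gamma> \<^bold>\<bottom> \<Longrightarrow> A \<in> I \<Longrightarrow> sequent I C \<Gamma> A"
| absurd_c: "sequent I C \<Gamma> (\<^bold>\<not> (\<^bold>\<not> A)) \<Longrightarrow> A \<in> C \<Longrightarrow> sequent I C \<Gamma> A"

lemma sequent_finite: "sequent I C \<Gamma> A \<Longrightarrow> finite \<Gamma>"
  by (induction rule: sequent.induct) auto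

definition derivable :: "'a fm set \<Rightarrow> 'a fm set \<Rightarrow> 'a fm set \<Rightarrow> 'a fm \<Rightarrow> bool" where
  "derivable I C \<Gamma> A \<longleftrightarrow> (\<exists>\<Delta>. finite \<Delta> \<and> \<Delta> \<subseteq> \<Gamma> \<and> sequent I C \<Delta> A)"

text \<open>On finite sets of hypotheses, \<open>derivable\<close> is derivability of the sequent itself.\<close>

lemma sequent_mono:
  assumes "finite \<Theta>" and "sequent I C \<Delta> A"
  shows "sequent I C (\<Theta> \<union> \<Delta>) A"
  using assms by (induction rule: finite_induct) (auto intro: weaken)

lemma derivable_finite_iff:
  assumes "finite \<Gamma>"
  shows "derivable I C \<Gamma> A \<longleftrightarrow> sequent I C \<Gamma> A"
proof
  assume "derivable I C \<Gamma> A"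
  then obtain \<Delta> where "\<Delta> \<subseteq> \<Gamma>" and "sequent I C \<Delta> A"
    unfolding derivable_def by blast
  then show "sequent I C \<Gamma> A"
    using sequent_mono[OF assms] by (metis Un_absorb2)
next
  assume "sequent I C \<Gamma> A"
  then show "derivable I C \<Gamma> A"
    unfolding derivable_def using assms by blast
qed


definition PLM :: "'v fm set \<Rightarrow> 'v fm \<Rightarrow> bool" (infix \<open>\<turnstile>\<^sub>m\<close> 50) where
  "\<Gamma> \<turnstile>\<^sub>m A \<longleftrightarrow> derivable {} {} \<Gamma> A"

definition PLI :: "'v fm set \<Rightarrow> 'v fm \<Rightarrow> bool" (infix \<open>\<turnstile>\<^sub>i\<close> 50) where
  "\<Gamma> \<turnstile>\<^sub>i A \<longleftrightarrow> derivable UNIV {} \<Gamma> A"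

definition PLC :: "'v fm set \<Rightarrow> 'v fm \<Rightarrow> bool" (infix \<open>\<turnstile>\<^sub>c\<close> 50) where
  "\<Gamma> \<turnstile>\<^sub>c A \<longleftrightarrow> derivable UNIV UNIV \<Gamma> A"


datatype 'v mvar = MinV 'v | IntV 'v | ClaV 'v

type_synonym 'v mfm = "'v mvar fm"

definition classical_fm :: "'v mfm set" where
  "classical_fm = {A. atoms A \<subseteq> range ClaV}"

definition intuitionistic_fm :: "'v mfm set" where
  "intuitionistic_fm = {A. atoms A \<subseteq> range IntV \<union> range ClaV}"

definition PML :: "'v mfm set \<Rightarrow> 'v mfm \<Rightarrow> bool" (infix \<open>\<turnstile>\<^sub>p\<^sub>m\<^sub>l\<close> 50) where
  "\<Gamma> \<turnstile>\<^sub>p\<^sub>m\<^sub>l A \<longleftrightarrow> derivable intuitionistic_fm classical_fm \<Gamma> A"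

definition PML_i :: "'v mfm set \<Rightarrow> 'v mfm \<Rightarrow> bool" (infix \<open>\<turnstile>\<^sub>'(\<^sub>i\<^sub>')\<close> 50) where
  "\<Gamma> \<turnstile>\<^sub>(\<^sub>i\<^sub>) A \<longleftrightarrow> derivable intuitionistic_fm {} \<Gamma> A"

definition PML_m :: "'v mfm set \<Rightarrow> 'v mfm \<Rightarrow> bool" (infix \<open>\<turnstile>\<^sub>'(\<^sub>m\<^sub>')\<close> 50) where
  "\<Gamma> \<turnstile>\<^sub>(\<^sub>m\<^sub>) A \<longleftrightarrow> derivable {} {} \<Gamma> A"


definition l_m :: "'v fm \<Rightarrow> 'v mfm" where "l_m = map_fm MinV"
definition l_i :: "'v fm \<Rightarrow> 'v mfm" where "l_i = map_fm IntV"
definition l_c :: "'v fm \<Rightarrow> 'v mfm" where "l_c = map_fm ClaV"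

end

theory Submission
  imports Defs
begin

text \<open>
  Renaming variables maps derivations to derivations, because every rule is schematic in its
  formulas; only the side conditions of the two absurdity rules need attention.  A label renames
  an ordinary derivation to a mixed one, where the side conditions hold because the label sends
  each formula to the fragment in which the rule in question is available.  Conversely, erasing
  all labels is again a renaming of variables.  It turns a mixed derivation, in which intermediate
  formulas may carry arbitrary labels, into an ordinary one, where the side conditions are vacuous:
  each ordinary system either lacks an absurdity rule, as does its mixed counterpart, or has it for
  all formulas.  Since erasure undoes each label, it recovers the original hypotheses and
  conclusion, so each of the three equivalences is an instance of \<open>derivable_map_fm_iff\<close>.
\<close>

lemma sequent_map_fm:
  assumes "sequent I C \<Gamma> A" and "map_fm f ` I \<subseteq> I'" and "map_fm f ` C \<subseteq> C'"
  shows "sequent I' C' (map_fm f ` \<Gamma>) (map_fm f A)"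
  using assms(1)
proof (induction rule: sequent.induct)
  case (orE \<Gamma>1 A1 A2 \<Gamma>2 B \<Gamma>3)
  then show ?case
    by (simp add: image_Un sequent.orE)
next
  case (impE \<Gamma>1 A1 A2 \<Gamma>2)
  then show ?case
    by (simp add: image_Un sequent.impE)
next
  case (absurd_i \<Gamma> A)
  then show ?case
    using assms(2) by (auto intro: sequent.absurd_i)
next
  case (absurd_c \<Gamma> A)
  then show ?case
    using assms(3) by (auto intro: sequent.absurd_c)
qed (auto simp: image_Un intro: sequent.intros)

lemma derivable_map_fm:
  assumes "derivable I C \<Gamma> A" and "map_fm f ` I \<subseteq> I'" and "map_fm f ` C \<subseteq> C'"
  shows "derivable I' C' (map_fm f ` \<Gamma>) (map_fm f A)"
  using assms sequent_map_fm unfolding derivable_def by (metis finite_imageI image_mono)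

text \<open>
  The left inverse \<open>g\<close> has to respect the absurdity rules on all of \<open>I'\<close> and \<open>C'\<close>, not only on
  the image of \<open>f\<close>: a derivation of a renamed formula may pass through formulas outside that image.
\<close>

lemma derivable_map_fm_iff:
  assumes inverse: "\<And>x. g (f x) = x"
    and f: "map_fm f ` I \<subseteq> I'" "map_fm f ` C \<subseteq> C'"
    and g: "map_fm g ` I' \<subseteq> I" "map_fm g ` C' \<subseteq> C"
  shows "derivable I C \<Gamma> A \<longleftrightarrow> derivable I' C' (map_fm f ` \<Gamma>) (map_fm f A)"
proof
  assume "derivable I C \<Gamma> A"
  then show "derivable I' C' (map_fm f ` \<Gamma>) (map_fm f A)"
    using f by (rule derivable_map_fm)
next
  assume "derivable I' C' (map_fm f ` \<Gamma>) (map_fm f A)"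
  then have "derivable I C (map_fm g ` map_fm f ` \<Gamma>) (map_fm g (map_fm f A))"
    using g by (rule derivable_map_fm)
  moreover have "map_fm g (map_fm f B) = B" for B
    by (simp add: fm.map_comp comp_def inverse fm.map_ident)
  ultimately show "derivable I C \<Gamma> A"
    by (simp add: image_image)
qed

fun unlabel :: "'v mvar \<Rightarrow> 'v" where
  "unlabel (MinV x) = x"
| "unlabel (IntV x) = x"
| "unlabel (ClaV x) = x"

theorem theorem39:
  fixes \<Gamma> :: "('v::countable) fm set" and A :: "'v fm"
  shows "(\<Gamma> \<turnstile>\<^sub>m A \<longleftrightarrow> l_m ` \<Gamma> \<turnstile>\<^sub>(\<^sub>m\<^sub>) l_m A)
       \<and> (\<Gamma> \<turnstile>\<^sub>i A \<longleftrightarrow> l_i ` \<Gamma> \<turnstile>\<^sub>(\<^sub>i\<^sub>) l_i A)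
       \<and> (\<Gamma> \<turnstile>\<^sub>c A \<longleftrightarrow> l_c ` \<Gamma> \<turnstile>\<^sub>p\<^sub>m\<^sub>l l_c A)"
proof (intro conjI)
  show "\<Gamma> \<turnstile>\<^sub>m A \<longleftrightarrow> l_m ` \<Gamma> \<turnstile>\<^sub>(\<^sub>m\<^sub>) l_m A"
    unfolding PLM_def PML_m_def l_m_def
    by (rule derivable_map_fm_iff[where g = unlabel]) auto
  show "\<Gamma> \<turnstile>\<^sub>i A \<longleftrightarrow> l_i ` \<Gamma> \<turnstile>\<^sub>(\<^sub>i\<^sub>) l_i A"
    unfolding PLI_def PML_i_def l_i_def
    by (rule derivable_map_fm_iff[where g = unlabel])
      (auto simp: intuitionistic_fm_def fm.set_map)
  show "\<Gamma> \<turnstile>\<^sub>c A \<longleftrightarrow> l_c ` \<Gamma> \<turnstile>\<^sub>p\<^sub>m\<^sub>l l_c A"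
    unfolding PLC_def PML_def l_c_def
    by (rule derivable_map_fm_iff[where g = unlabel])
      (auto simp: intuitionistic_fm_def classical_fm_def fm.set_map)
qed

end
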